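(* For $i=1,2$, let $Y_i$ be a compact Hausdorff space without isolated points and $A_i\subseteq Y_i$ a finite nonempty subset such that $Y_i\setminus A_i$ is first-countable, and let $X_i=\mathrm{FMQ}(Y_i,A_i,\mathcal{D}_{Y_i})$. Then $X_1\times X_2$ is US, $k_2$-Hausdorff, not KC, and not weakly Hausdorff.
   Context: For a topological space $Y$ and nonempty $A\subseteq Y$, let $q\colon Y\to Y/A$ be the projection (of sets) collapsing $A$ to one point $\ast=q(A)$, and let $\mathcal{D}_Y$ be the collection of dense subsets of $Y$. $\mathrm{FMQ}(Y,A,\mathcal{D}_Y)$ is the set $Y/A$ with the topology consisting of all $U\subseteq Y/A$ such that $q^{-1}(U)$ is open in $Y$ and ($\ast\in U\Rightarrow q^{-1}(U)$ is dense in $Y$). A space $X$ is US if every convergent sequence has a unique limit; KC if every compact subset is closed; weakly Hausdorff if for every compact Hausdorff $K$ and continuous $f\colon K\to X$ the image $f(K)$ is closed; $k_2$-Hausdorff if for every compact Hausdorff $K$ and continuous $f\colon K\to X$ the set $\{(a,b)\in K\times K:f(a)=f(b)\}$ is closed in $K\times K$. *)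

theory Defs
  imports "HOL-Analysis.Analysis"
begin

text \<open>Points of \<open>Y/A\<close> are the equivalence classes themselves: the point \<open>*\<close> is the set \<open>A\<close>,
  every other point is a singleton \<open>{y}\<close> with \<open>y \<notin> A\<close>.\<close>

definition collapse :: "'a set \<Rightarrow> 'a \<Rightarrow> 'a set"
  where "collapse A y = (if y \<in> A then A else {y})"

definition dense_sets :: "'a topology \<Rightarrow> 'a set set"
  where "dense_sets Y = {D. D \<subseteq> topspace Y \<and> Y closure_of D = topspace Y}"

text \<open>The predicate below need not be a topology for an arbitrary collection \<open>\<D>\<close>;
  for \<open>\<D> = dense_sets Y\<close> it is one, see \<open>openin_FMQ\<close>.\<close>

definition FMQ :: "'a topology \<Rightarrow> 'a set \<Rightarrow> 'a set set \<Rightarrow> 'a set topology"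
  where "FMQ Y A \<D> = topology (\<lambda>U. U \<subseteq> collapse A ` topspace Y \<and>
           openin Y {y \<in> topspace Y. collapse A y \<in> U} \<and>
           (A \<in> U \<longrightarrow> {y \<in> topspace Y. collapse A y \<in> U} \<in> \<D>))"

lemma dense_sets_mono:
  assumes "D \<in> dense_sets Y" "D \<subseteq> E" "E \<subseteq> topspace Y"
  shows "E \<in> dense_sets Y"
proof -
  have "topspace Y \<subseteq> Y closure_of E"
    using closure_of_mono[OF assms(2), of Y] assms(1) by (simp add: dense_sets_def)
  then have "Y closure_of E = topspace Y"
    by (rule antisym[OF closure_of_subset_topspace])
  then show ?thesis using assms(3) by (simp add: dense_sets_def)
qed

lemma dense_sets_Int:
  assumes "D \<in> dense_sets Y" "E \<in> dense_sets Y" "openin Y D"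
  shows "D \<inter> E \<in> dense_sets Y"
proof -
  have "D \<inter> Y closure_of E \<subseteq> Y closure_of (D \<inter> E)"
    using assms(3) by (rule openin_Int_closure_of_subset)
  then have "D \<subseteq> Y closure_of (D \<inter> E)"
    using assms by (auto simp: dense_sets_def)
  then have "topspace Y \<subseteq> Y closure_of (D \<inter> E)"
    using assms(1) closure_of_minimal[of D "Y closure_of (D \<inter> E)" Y]
    by (simp add: dense_sets_def)
  then have "Y closure_of (D \<inter> E) = topspace Y"
    by (rule antisym[OF closure_of_subset_topspace])
  then show ?thesis using assms(1) by (auto simp: dense_sets_def)
qed

lemma istopology_FMQ:
  "istopology (\<lambda>U. U \<subseteq> collapse A ` topspace Y \<and>
     openin Y {y \<in> topspace Y. collapse A y \<in> U} \<and>
     (A \<in> U \<longrightarrow> {y \<in> topspace Y. collapse A y \<in> U} \<in> dense_sets Y))"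
    (is "istopology (\<lambda>U. U \<subseteq> ?Q \<and> openin Y (?p U) \<and> (A \<in> U \<longrightarrow> ?p U \<in> dense_sets Y))")
proof -
  have I: "S \<inter> T \<subseteq> ?Q \<and> openin Y (?p (S \<inter> T)) \<and> (A \<in> S \<inter> T \<longrightarrow> ?p (S \<inter> T) \<in> dense_sets Y)"
    if S: "S \<subseteq> ?Q \<and> openin Y (?p S) \<and> (A \<in> S \<longrightarrow> ?p S \<in> dense_sets Y)"
      and T: "T \<subseteq> ?Q \<and> openin Y (?p T) \<and> (A \<in> T \<longrightarrow> ?p T \<in> dense_sets Y)" for S T
  proof -
    have eq: "?p (S \<inter> T) = ?p S \<inter> ?p T" by blast
    have "openin Y (?p S \<inter> ?p T)" using S T by (intro openin_Int) simp_all
    moreover have "?p S \<inter> ?p T \<in> dense_sets Y" if "A \<in> S \<inter> T"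
      using S T that by (intro dense_sets_Int) simp_all
    ultimately show ?thesis unfolding eq using S by blast
  qed
  have U: "\<Union>\<K> \<subseteq> ?Q \<and> openin Y (?p (\<Union>\<K>)) \<and> (A \<in> \<Union>\<K> \<longrightarrow> ?p (\<Union>\<K>) \<in> dense_sets Y)"
    if K: "\<forall>U\<in>\<K>. U \<subseteq> ?Q \<and> openin Y (?p U) \<and> (A \<in> U \<longrightarrow> ?p U \<in> dense_sets Y)" for \<K>
  proof (intro conjI impI)
    have eq: "?p (\<Union>\<K>) = (\<Union>U\<in>\<K>. ?p U)" by blast
    show "\<Union>\<K> \<subseteq> ?Q" using K by blast
    show "openin Y (?p (\<Union>\<K>))" unfolding eq using K by (intro openin_Union) blast
    assume "A \<in> \<Union>\<K>"
    then obtain U where U: "U \<in> \<K>" "A \<in> U" by blast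
    then have "?p U \<in> dense_sets Y" using K by blast
    then show "?p (\<Union>\<K>) \<in> dense_sets Y"
      by (rule dense_sets_mono) (use U in blast)+
  qed
  show ?thesis
    unfolding istopology_def
  proof (rule conjI)
    show "\<forall>S T. S \<subseteq> ?Q \<and> openin Y (?p S) \<and> (A \<in> S \<longrightarrow> ?p S \<in> dense_sets Y) \<longrightarrow>
        T \<subseteq> ?Q \<and> openin Y (?p T) \<and> (A \<in> T \<longrightarrow> ?p T \<in> dense_sets Y) \<longrightarrow>
        S \<inter> T \<subseteq> ?Q \<and> openin Y (?p (S \<inter> T)) \<and> (A \<in> S \<inter> T \<longrightarrow> ?p (S \<inter> T) \<in> dense_sets Y)"
      by (rule allI, rule allI, rule impI, rule impI, rule I)
    show "\<forall>\<K>. (\<forall>U\<in>\<K>. U \<subseteq> ?Q \<and> openin Y (?p U) \<and> (A \<in> U \<longrightarrow> ?p U \<in> dense_sets Y)) \<longrightarrow>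
        \<Union>\<K> \<subseteq> ?Q \<and> openin Y (?p (\<Union>\<K>)) \<and> (A \<in> \<Union>\<K> \<longrightarrow> ?p (\<Union>\<K>) \<in> dense_sets Y)"
      by (rule allI, rule impI, rule U)
  qed
qed

lemma openin_FMQ:
  "openin (FMQ Y A (dense_sets Y)) U \<longleftrightarrow> U \<subseteq> collapse A ` topspace Y \<and>
     openin Y {y \<in> topspace Y. collapse A y \<in> U} \<and>
     (A \<in> U \<longrightarrow> {y \<in> topspace Y. collapse A y \<in> U} \<in> dense_sets Y)"
  unfolding FMQ_def by (subst topology_inverse'[OF istopology_FMQ]) (rule refl)

lemma topspace_FMQ: "topspace (FMQ Y A (dense_sets Y)) = collapse A ` topspace Y"
proof
  show "topspace (FMQ Y A (dense_sets Y)) \<subseteq> collapse A ` topspace Y"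
    using openin_FMQ[of Y A] openin_topspace by blast
  have "{y \<in> topspace Y. collapse A y \<in> collapse A ` topspace Y} = topspace Y" by auto
  then have "openin (FMQ Y A (dense_sets Y)) (collapse A ` topspace Y)"
    unfolding openin_FMQ by (simp add: dense_sets_def)
  then show "collapse A ` topspace Y \<subseteq> topspace (FMQ Y A (dense_sets Y))"
    by (rule openin_subset)
qed

definition US_space :: "'a topology \<Rightarrow> bool"
  where "US_space X \<longleftrightarrow> (\<forall>\<sigma> :: nat \<Rightarrow> 'a. \<forall>l m.
           limitin X \<sigma> l sequentially \<and> limitin X \<sigma> m sequentially \<longrightarrow> l = m)"

text \<open>The test spaces \<open>K\<close> are carried by subsets of the type \<open>'k\<close>.  A statement
  in which \<open>'k\<close> is a free type variable, occurring nowhere else, therefore speaks of all compact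
  Hausdorff spaces.\<close>

definition k2_Hausdorff_space :: "'k itself \<Rightarrow> 'a topology \<Rightarrow> bool"
  where "k2_Hausdorff_space TYPE('k) X \<longleftrightarrow> (\<forall>(K :: 'k topology) f.
           compact_space K \<and> Hausdorff_space K \<and> continuous_map K X f \<longrightarrow>
           closedin (prod_topology K K) {(a, b) \<in> topspace K \<times> topspace K. f a = f b})"

text \<open>Here test spaces on one type, determined by the type of points of \<open>X\<close>, are enough, so
  that the negation of the property also has its full meaning: \<open>weakly_Hausdorff_spaceD\<close> below
  derives the condition for \<open>K\<close> over an arbitrary type.\<close>

definition weakly_Hausdorff_space :: "'a topology \<Rightarrow> bool"
  where "weakly_Hausdorff_space X \<longleftrightarrow> (\<forall>(K :: 'a set set topology) f.
           compact_space K \<and> Hausdorff_space K \<and> continuous_map K X f \<longrightarrow>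
           closedin X (f ` topspace K))"

text \<open>Choose one point in each fibre of \<open>f\<close>.  The closure \<open>L\<close> of the set of chosen points has
  the same image as \<open>K\<close>, and a point of \<open>L\<close> is determined by the sets of chosen points
  to which it is adherent.\<close>

lemma weakly_Hausdorff_spaceD:
  fixes X :: "'a topology" and K :: "'k topology"
  assumes X: "weakly_Hausdorff_space X" and K: "compact_space K" "Hausdorff_space K"
    and f: "continuous_map K X f"
  shows "closedin X (f ` topspace K)"
proof -
  define S where "S = f ` topspace K"
  define sel where "sel = inv_into (topspace K) f"
  define L where "L = K closure_of (sel ` S)"
  define code where "code p = {T. T \<subseteq> S \<and> p \<in> K closure_of (sel ` T)}" for p
  have sel: "sel s \<in> topspace K" "f (sel s) = s" if "s \<in> S" for s
    using that unfolding S_def sel_def by (rule inv_into_into, rule f_inv_into_f)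
  have LK: "L \<subseteq> topspace K" by (simp add: L_def closure_of_subset_topspace)
  have selL: "sel ` S \<subseteq> L"
    unfolding L_def using sel by (intro closure_of_subset) auto
  have fL: "f ` L = S"
  proof
    show "f ` L \<subseteq> S" using LK by (auto simp: S_def)
    show "S \<subseteq> f ` L"
    proof
      fix s assume "s \<in> S"
      then have "sel s \<in> L" "s = f (sel s)" using selL sel by auto
      then show "s \<in> f ` L" by (rule rev_image_eqI)
    qed
  qed
  have "p = p'" if p: "p \<in> L" "p' \<in> L" "code p = code p'" for p p'
  proof (rule ccontr)
    assume "p \<noteq> p'"
    moreover have "p \<in> topspace K" "p' \<in> topspace K" using p(1,2) LK by blast+
    ultimately obtain U V
      where UV: "openin K U" "openin K V" "p \<in> U" "p' \<in> V" "disjnt U V"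
      using K(2)[unfolded Hausdorff_space_def, rule_format, of p p'] by blast
    define T where "T = {s \<in> S. sel s \<in> U}"
    have "p \<in> K closure_of (U \<inter> sel ` S)"
      using openin_Int_closure_of_subset[OF UV(1), of "sel ` S"] UV(3) p(1)
      unfolding L_def by blast
    moreover have "U \<inter> sel ` S = sel ` T" by (auto simp: T_def)
    ultimately have "T \<in> code p" by (auto simp: code_def T_def)
    then have "T \<in> code p'" unfolding p(3) .
    then have "p' \<in> K closure_of (sel ` T)" by (simp add: code_def)
    moreover have "V \<inter> sel ` T = {}" using UV by (auto simp: T_def disjnt_def)
    ultimately show False using UV(2,4) unfolding in_closure_of by blast
  qed
  then have inj: "inj_on code L" by (rule inj_onI)
  define K' where "K' = subtopology K L"
  define g where "g = inv_into L code"
  define J where "J = pullback_topology (code ` L) g K'"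
  have topK': "topspace K' = L" using LK by (auto simp: K'_def)
  have gL: "g (code p) = p" if "p \<in> L" for p using that inj by (simp add: g_def)
  have topJ: "topspace J = code ` L"
    by (auto simp: J_def topspace_pullback_topology topK' gL)
  have gJ: "continuous_map J K' g"
    using continuous_map_pullback[OF continuous_map_id, of "code ` L" g K']
    by (simp add: J_def o_def)
  have "continuous_map K' J code"
    unfolding J_def
    by (rule continuous_map_pullback')
      (auto simp: topK' gL intro: continuous_map_eq[OF continuous_map_id])
  then have "homeomorphic_maps K' J code g"
    using gJ by (auto simp: homeomorphic_maps_def topK' topJ gL)
  then have hom: "K' homeomorphic_space J" by (auto simp: homeomorphic_space_def)
  have "compact_space K'"
    using K by (simp add: K'_def L_def closedin_compact_space compact_space_subtopology)
  then have "compact_space J" using homeomorphic_compact_space[OF hom] by simp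
  moreover have "Hausdorff_space J"
    using homeomorphic_Hausdorff_space[OF hom] Hausdorff_space_subtopology[OF K(2), of L]
    by (simp add: K'_def)
  moreover have "continuous_map J X (f \<circ> g)"
    using gJ f unfolding K'_def
    by (intro continuous_map_compose[OF continuous_map_into_fulltopology])
  ultimately have "closedin X ((f \<circ> g) ` topspace J)"
    using X[unfolded weakly_Hausdorff_space_def, rule_format, of J "f \<circ> g"] by simp
  moreover have "(f \<circ> g) ` topspace J = S"
    using gL by (simp add: topJ image_image fL[symmetric])
  ultimately show ?thesis by (simp add: S_def)
qed

end

theory Submission
  imports Defs
begin

text \<open>A set missing \<open>A\<close> is closed in the quotient iff it is closed and nowhere dense in \<open>Y\<close>.
  As \<open>Y\<close> has no isolated points, a convergent sequence off \<open>A\<close> together with its limit \<open>y\<close> is nowhere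
  dense; so the tails of the sequence, with \<open>y\<close> added, are closed in the quotient and intersect
  in \<open>y\<close> alone.  This gives unique limits, and, picking such sequences inside a countable
  neighbourhood base at \<open>y\<close>, the \<open>k\<^sub>2\<close>-Hausdorff property.  On the other hand a closed
  neighbourhood of a point off \<open>A\<close> is compact Hausdorff but has interior, so its image is not
  closed.  All this transfers to the product factor by factor.\<close>

section \<open>Passage between the product and its factors\<close>

lemma US_space_prod_topology:
  fixes X1 :: "'a topology" and X2 :: "'b topology"
  assumes "US_space X1" "US_space X2"
  shows "US_space (prod_topology X1 X2)"
  unfolding US_space_def
proof (intro allI impI)
  fix \<sigma> :: "nat \<Rightarrow> 'a \<times> 'b" and l m
  assume "limitin (prod_topology X1 X2) \<sigma> l sequentially \<and>
    limitin (prod_topology X1 X2) \<sigma> m sequentially"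
  then have "fst l = fst m" "snd l = snd m"
    using assms unfolding US_space_def limitin_pairwise by blast+
  then show "l = m" by (rule prod_eqI)
qed

lemma k2_Hausdorff_space_prod_topology:
  assumes "k2_Hausdorff_space TYPE('k) X1" "k2_Hausdorff_space TYPE('k) X2"
  shows "k2_Hausdorff_space TYPE('k) (prod_topology X1 X2)"
  unfolding k2_Hausdorff_space_def
proof (intro allI impI)
  fix K :: "'k topology" and f
  assume K: "compact_space K \<and> Hausdorff_space K \<and> continuous_map K (prod_topology X1 X2) f"
  let ?E = "\<lambda>g. {(a, b) \<in> topspace K \<times> topspace K. g a = g b}"
  have "closedin (prod_topology K K) (?E (fst \<circ> f))" "closedin (prod_topology K K) (?E (snd \<circ> f))"
    using K assms unfolding k2_Hausdorff_space_def continuous_map_pairwise by blast+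
  then have "closedin (prod_topology K K) (?E (fst \<circ> f) \<inter> ?E (snd \<circ> f))"
    by (rule closedin_Int)
  \<comment> \<open>Two pairs agree iff both coordinates agree, so the coincidence set of
    \<open>f\<close> is cut out by those of its components.\<close>
  moreover have "?E f = ?E (fst \<circ> f) \<inter> ?E (snd \<circ> f)" by (auto intro: prod_eqI)
  ultimately show "closedin (prod_topology K K) (?E f)" by (simp only:)
qed

text \<open>Continuous images of compact spaces are compact. Used contrapositively: failure of weak
  Hausdorffness also refutes KC.\<close>

lemma kc_space_imp_weakly_Hausdorff_space:
  fixes X :: "'a topology"
  assumes "kc_space X"
  shows "weakly_Hausdorff_space X"
  unfolding weakly_Hausdorff_space_def
proof (intro allI impI)
  fix K :: "'a set set topology" and f
  assume "compact_space K \<and> Hausdorff_space K \<and> continuous_map K X f"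
  then have "compactin X (f ` topspace K)"
    by (intro image_compactin[of K]) (simp_all add: compact_space_def)
  then show "closedin X (f ` topspace K)" using assms unfolding kc_space_def by blast
qed

text \<open>A test map into the first factor is moved into the slice at height \<open>c\<close>;
  closedness of its image there projects back.\<close>

lemma weakly_Hausdorff_space_prod_topologyD:
  fixes X1 :: "'a topology" and X2 :: "'b topology"
  assumes X: "weakly_Hausdorff_space (prod_topology X1 X2)" and c: "c \<in> topspace X2"
  shows "weakly_Hausdorff_space X1"
  unfolding weakly_Hausdorff_space_def
proof (intro allI impI)
  fix K :: "'a set set topology" and f
  assume K: "compact_space K \<and> Hausdorff_space K \<and> continuous_map K X1 f"
  then have "continuous_map K (prod_topology X1 X2) (\<lambda>x. (f x, c))"
    using c by (intro continuous_map_pairedI) auto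
  \<comment> \<open>\<open>K\<close> lives on the test type of \<open>X1\<close>, not on that of the
    product, so the form for arbitrary types is applied.\<close>
  then have "closedin (prod_topology X1 X2) ((\<lambda>x. (f x, c)) ` topspace K)"
    using weakly_Hausdorff_spaceD[OF X] K by blast
  moreover have "(\<lambda>x. (f x, c)) ` topspace K = f ` topspace K \<times> {c}" by auto
  ultimately show "closedin X1 (f ` topspace K)"
    by (auto simp: closedin_prod_Times_iff)
qed

section \<open>Countable bases and convergent sequences\<close>

text \<open>The base is made decreasing so that any choice of one point from each \<open>W n\<close>
  converges to \<open>x\<close>.\<close>

lemma first_countable_decseq_base:
  assumes "first_countable X" "x \<in> topspace X"
  obtains W :: "nat \<Rightarrow> 'a set"
  where "\<And>n. openin X (W n)" "\<And>n. x \<in> W n" "decseq W"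
    "\<And>U. openin X U \<Longrightarrow> x \<in> U \<Longrightarrow> \<exists>n. W n \<subseteq> U"
proof -
  obtain \<B> where \<B>: "countable \<B>" "\<And>V. V \<in> \<B> \<Longrightarrow> openin X V"
    "\<And>U. openin X U \<Longrightarrow> x \<in> U \<Longrightarrow> \<exists>V\<in>\<B>. x \<in> V \<and> V \<subseteq> U"
    using assms unfolding first_countable_def by meson
  define \<C> where "\<C> = {V \<in> \<B>. x \<in> V}"
  have C: "countable \<C>" "\<C> \<noteq> {}"
    using \<B>(1) \<B>(3)[OF openin_topspace assms(2)] by (auto simp: \<C>_def)
  \<comment> \<open>Since \<open>\<C>\<close> is nonempty, \<open>from_nat_into\<close> stays in
    \<open>\<C>\<close> at every index, even when \<open>\<C>\<close> is finite.\<close>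
  define W where "W n = (\<Inter>i\<le>n. from_nat_into \<C> i)" for n
  have in_C: "from_nat_into \<C> i \<in> \<C>" for i using C(2) by (rule from_nat_into)
  show ?thesis
  proof
    show "openin X (W n)" for n
      unfolding W_def using in_C \<B>(2) by (intro openin_Inter) (auto simp: \<C>_def)
    show "x \<in> W n" for n using in_C by (auto simp: W_def \<C>_def)
    show "decseq W" by (force simp: W_def decseq_def)
    fix U assume "openin X U" "x \<in> U"
    then obtain V where V: "V \<in> \<C>" "V \<subseteq> U" using \<B>(3) by (auto simp: \<C>_def)
    obtain n where "from_nat_into \<C> n = V" using from_nat_into_surj[OF C(1) V(1)] by blast
    then have "W n \<subseteq> V" by (auto simp: W_def)
    then show "\<exists>n. W n \<subseteq> U" using V(2) by blast
  qed
qed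

text \<open>A neighbourhood of \<open>y\<close> that omits \<open>z\<close> contains a whole tail
  together with \<open>y\<close>.\<close>

lemma mem_all_tails_imp_eq_limit:
  assumes "t1_space X" "limitin X \<tau> y sequentially" "range \<tau> \<subseteq> topspace X"
    and z: "\<And>N. z \<in> insert y (\<tau> ` {N..})"
  shows "z = y"
proof (rule ccontr)
  assume "z \<noteq> y"
  moreover have y: "y \<in> topspace X" using assms(2) by (rule limitin_topspace)
  moreover have "z \<in> topspace X" using z[of 0] y assms(3) by auto
  ultimately obtain U where U: "openin X U" "y \<in> U" "z \<notin> U"
    using assms(1) unfolding t1_space_def by metis
  then obtain N where "\<And>n. n \<ge> N \<Longrightarrow> \<tau> n \<in> U"
    using assms(2) unfolding limitin_sequentially by meson
  then show False using z[of N] U by auto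
qed

lemma closedin_tail_with_limit:
  assumes "Hausdorff_space X" "limitin X \<tau> y sequentially" "range \<tau> \<subseteq> topspace X"
  shows "closedin X (insert y (\<tau> ` {N..}))"
  using assms by (intro compactin_imp_closedin compactin_sequence_with_limit) auto

text \<open>Away from the limit only finitely many terms accumulate, so a nonempty open subset would
  yield a nonempty finite open set, and hence an isolated point.\<close>

lemma interior_of_sequence_with_limit:
  assumes Y: "Hausdorff_space Y" "\<And>y. y \<in> topspace Y \<Longrightarrow> \<not> openin Y {y}"
    and lim: "limitin Y \<tau> y sequentially"
  shows "Y interior_of (insert y (range \<tau>)) = {}"
  unfolding interior_of_eq_empty
proof (intro allI impI)
  fix W assume W: "openin Y W \<and> W \<subseteq> insert y (range \<tau>)"
  have Wt: "W \<subseteq> topspace Y" using W openin_subset by blast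
  have y: "y \<in> topspace Y" using lim by (rule limitin_topspace)
  \<comment> \<open>In a T1 space the other points of a finite open set form a closed set; deleting
    them leaves an open singleton.\<close>
  have fin: False if G: "openin Y G" "finite G" "G \<noteq> {}" for G
  proof -
    obtain w where w: "w \<in> G" using G(3) by blast
    have Gt: "G \<subseteq> topspace Y" using G(1) by (rule openin_subset)
    then have "closedin Y (G - {w})"
      using Hausdorff_imp_t1_space[OF Y(1)] G(2) unfolding t1_space_closedin_finite by blast
    then have "openin Y (G - (G - {w}))" using G(1) by (intro openin_diff)
    moreover have "G - (G - {w}) = {w}" using w by blast
    ultimately show False using Y(2) w Gt by auto
  qed
  show "W = {}"
  proof (rule ccontr)
    assume "W \<noteq> {}"
    have "\<not> W \<subseteq> {y}" using fin[of W] W \<open>W \<noteq> {}\<close> finite_subset by blast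
    then obtain w where w: "w \<in> W" "w \<noteq> y" by blast
    then obtain U V where UV: "openin Y U" "openin Y V" "w \<in> U" "y \<in> V" "disjnt U V"
      using Y(1)[unfolded Hausdorff_space_def, rule_format, of w y] y Wt by blast
    then obtain N where N: "\<And>n. n \<ge> N \<Longrightarrow> \<tau> n \<in> V"
      using lim unfolding limitin_sequentially by meson
    have "W \<inter> U \<subseteq> \<tau> ` {..<N}"
    proof
      fix z assume z: "z \<in> W \<inter> U"
      then have "z \<notin> V" using UV by (auto simp: disjnt_def)
      then obtain n where n: "z = \<tau> n" using z W UV(4) by auto
      then have "n < N" using N[of n] \<open>z \<notin> V\<close> by (cases "n < N") auto
      then show "z \<in> \<tau> ` {..<N}" using n by auto
    qed
    then have "finite (W \<inter> U)" by (rule finite_subset) simp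
    then show False using fin[of "W \<inter> U"] W UV w by (auto intro: openin_Int)
  qed
qed

section \<open>Open and closed sets of a single quotient\<close>

locale finite_collapse =
  fixes Y :: "'a topology" and A :: "'a set"
  assumes Hausdorff: "Hausdorff_space Y"
    and no_isolated: "\<And>y. y \<in> topspace Y \<Longrightarrow> \<not> openin Y {y}"
    and A_subset: "A \<subseteq> topspace Y" and finite_A: "finite A" and A_nonempty: "A \<noteq> {}"
begin

abbreviation X :: "'a set topology" where "X \<equiv> FMQ Y A (dense_sets Y)"

lemma closedin_A: "closedin Y A"
  using Hausdorff_imp_t1_space[OF Hausdorff] A_subset finite_A
  by (simp add: t1_space_closedin_finite)

lemma openin_off_A: "openin Y (topspace Y - A)"
  using closedin_A by blast

lemma topspace_X: "topspace X = insert A ((\<lambda>y. {y}) ` (topspace Y - A))"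
  using A_subset A_nonempty by (auto simp: topspace_FMQ collapse_def image_iff)

text \<open>The complement of the image contains the point \<open>A\<close>, so the density
  condition applies to it; a dense complement means an empty interior.\<close>

lemma closedin_X_iff:
  assumes "C \<subseteq> topspace Y - A"
  shows "closedin X ((\<lambda>y. {y}) ` C) \<longleftrightarrow> closedin Y C \<and> Y interior_of C = {}"
proof -
  let ?U = "topspace X - (\<lambda>y. {y}) ` C"
  have sub: "(\<lambda>y. {y}) ` C \<subseteq> topspace X" using assms by (auto simp: topspace_X)
  have AU: "A \<in> ?U" using assms by (auto simp: topspace_X)
  have pre: "{y \<in> topspace Y. collapse A y \<in> ?U} = topspace Y - C"
    using assms AU by (auto simp: collapse_def topspace_X)
  have "closedin X ((\<lambda>y. {y}) ` C) \<longleftrightarrow> openin X ?U" using sub by (simp add: closedin_def)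
  also have "\<dots> \<longleftrightarrow> openin Y (topspace Y - C) \<and> topspace Y - C \<in> dense_sets Y"
    unfolding openin_FMQ pre using AU by (auto simp: topspace_FMQ)
  also have "\<dots> \<longleftrightarrow> closedin Y C \<and> Y interior_of C = {}"
    using assms by (auto simp: closedin_def dense_sets_def interior_of_eq_empty_complement)
  finally show ?thesis .
qed

text \<open>The image omits the point \<open>A\<close>, so the density condition is vacuous: off
  \<open>A\<close> the quotient has the open sets of \<open>Y\<close>.\<close>

lemma openin_X_off_A:
  assumes "openin Y U" "U \<inter> A = {}"
  shows "openin X ((\<lambda>y. {y}) ` U)"
proof -
  have U: "U \<subseteq> topspace Y" using assms(1) by (rule openin_subset)
  have "A \<notin> (\<lambda>y. {y}) ` U" using assms(2) by auto
  moreover from this have "{y \<in> topspace Y. collapse A y \<in> (\<lambda>y. {y}) ` U} = U"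
    using U assms(2) by (auto simp: collapse_def)
  moreover have "(\<lambda>y. {y}) ` U \<subseteq> collapse A ` topspace Y"
    using U assms(2) by (auto simp: collapse_def image_iff intro!: bexI)
  ultimately show ?thesis using assms(1) by (simp add: openin_FMQ)
qed

lemma continuous_map_collapse: "continuous_map Y X (collapse A)"
  unfolding continuous_map_def topspace_FMQ by (auto simp: openin_FMQ)

lemma closedin_X_singleton:
  assumes "y \<in> topspace Y - A"
  shows "closedin X {{y}}"
proof -
  have "Y interior_of {y} = {}"
    using no_isolated[of y] assms unfolding interior_of_eq_empty by (auto simp: subset_singleton_iff)
  then show ?thesis
    using closedin_X_iff[of "{y}"] closedin_Hausdorff_singleton[OF Hausdorff] assms by simp
qed

text \<open>These closed sets trap every limit of the sequence in \<open>X\<close>, the point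
  \<open>A\<close> included.\<close>

lemma closedin_X_tail:
  assumes lim: "limitin Y \<tau> y sequentially" and y: "y \<notin> A" and \<tau>: "range \<tau> \<subseteq> topspace Y - A"
  shows "closedin X ((\<lambda>y. {y}) ` insert y (\<tau> ` {N..}))"
proof (subst closedin_X_iff)
  have yt: "y \<in> topspace Y" using lim by (rule limitin_topspace)
  then show "insert y (\<tau> ` {N..}) \<subseteq> topspace Y - A" using y \<tau> by blast
  have "Y interior_of (insert y (\<tau> ` {N..})) \<subseteq> Y interior_of (insert y (range \<tau>))"
    by (intro interior_of_mono) auto
  then show "closedin Y (insert y (\<tau> ` {N..})) \<and> Y interior_of (insert y (\<tau> ` {N..})) = {}"
    using interior_of_sequence_with_limit[OF Hausdorff no_isolated lim]
      closedin_tail_with_limit[OF Hausdorff lim] \<tau> by blast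
qed

lemma mem_all_tails:
  assumes "limitin Y \<tau> y sequentially" "range \<tau> \<subseteq> topspace Y - A"
    and "\<And>N. p \<in> (\<lambda>y. {y}) ` insert y (\<tau> ` {N..})"
  shows "p = {y}"
proof -
  obtain z where p: "p = {z}" using assms(3)[of 0] by blast
  have "z = y"
  proof (rule mem_all_tails_imp_eq_limit[OF Hausdorff_imp_t1_space[OF Hausdorff] assms(1)])
    show "range \<tau> \<subseteq> topspace Y" using assms(2) by blast
    show "z \<in> insert y (\<tau> ` {N..})" for N using assms(3)[of N] p by auto
  qed
  then show ?thesis using p by simp
qed

section \<open>Uniqueness of sequential limits\<close>

lemma limitin_X_unique_off_A:
  assumes y: "y \<in> topspace Y - A" and l: "limitin X \<sigma> {y} sequentially"
    and m: "limitin X \<sigma> m sequentially"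
  shows "m = {y}"
proof -
  \<comment> \<open>The complement of \<open>A\<close> gives a neighbourhood of \<open>{y}\<close>,
    so from some \<open>N\<close> on the sequence lifts to points of \<open>Y\<close>.\<close>
  have "\<forall>\<^sub>F n in sequentially. \<sigma> n \<in> (\<lambda>y. {y}) ` (topspace Y - A)"
    using limitinD[OF l openin_X_off_A[OF openin_off_A]] y by auto
  then obtain N where N: "\<And>n. n \<ge> N \<Longrightarrow> \<sigma> n \<in> (\<lambda>y. {y}) ` (topspace Y - A)"
    unfolding eventually_sequentially by blast
  have "\<exists>z. \<sigma> (n + N) = {z} \<and> z \<in> topspace Y - A" for n
    using N[of "n + N"] by auto
  then obtain \<tau> where \<tau>: "\<And>n. \<sigma> (n + N) = {\<tau> n}" "\<And>n. \<tau> n \<in> topspace Y - A"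
    by metis
  have lim: "limitin Y \<tau> y sequentially"
    unfolding limitin_def
  proof (intro conjI allI impI)
    show "y \<in> topspace Y" using y by simp
    fix U assume U: "openin Y U \<and> y \<in> U"
    then have "openin X ((\<lambda>y. {y}) ` (U \<inter> (topspace Y - A)))"
      by (intro openin_X_off_A openin_Int openin_off_A) auto
    from limitinD[OF limitin_sequentially_offset[OF l, of N] this]
    have "\<forall>\<^sub>F n in sequentially. \<sigma> (n + N) \<in> (\<lambda>y. {y}) ` (U \<inter> (topspace Y - A))"
      using U y by simp
    then show "\<forall>\<^sub>F n in sequentially. \<tau> n \<in> U"
      by (rule eventually_mono) (auto simp: \<tau>(1))
  qed
  \<comment> \<open>The shifted sequence is eventually in each of these closed sets, so its other
    limit \<open>m\<close> is in all of them.\<close>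
  have "m \<in> (\<lambda>y. {y}) ` insert y (\<tau> ` {M..})" for M
  proof (rule limitin_closedin[OF limitin_sequentially_offset[OF m, of N]])
    show "closedin X ((\<lambda>y. {y}) ` insert y (\<tau> ` {M..}))"
      using lim y \<tau>(2) by (intro closedin_X_tail) auto
    show "\<forall>\<^sub>F n in sequentially. \<sigma> (n + N) \<in> (\<lambda>y. {y}) ` insert y (\<tau> ` {M..})"
      unfolding \<tau>(1) eventually_sequentially by auto
  qed simp
  then show "m = {y}" using mem_all_tails[OF lim] \<tau>(2) by blast
qed

lemma US_space_X: "US_space X"
  unfolding US_space_def
proof (intro allI impI)
  fix \<sigma> :: "nat \<Rightarrow> 'a set" and l m
  assume "limitin X \<sigma> l sequentially \<and> limitin X \<sigma> m sequentially"
  then have l: "limitin X \<sigma> l sequentially" and m: "limitin X \<sigma> m sequentially" by simp_all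
  \<comment> \<open>Limits that are both \<open>A\<close> agree trivially; otherwise one lies off
    \<open>A\<close> and determines the other.\<close>
  consider "l = A" "m = A" | y where "y \<in> topspace Y - A" "l = {y}"
    | y where "y \<in> topspace Y - A" "m = {y}"
    using limitin_topspace[OF l] limitin_topspace[OF m] unfolding topspace_X by blast
  then show "l = m"
  proof cases
    case 2 then show ?thesis using limitin_X_unique_off_A l m by metis
  next
    case 3 then show ?thesis using limitin_X_unique_off_A l m by metis
  qed simp
qed

section \<open>Coincidence sets of maps from compact Hausdorff spaces\<close>

text \<open>If \<open>f a\<close> is \<open>A\<close>, its neighbourhoods in \<open>X\<close> have
  dense preimages and meet every neighbourhood of \<open>{y}\<close>. The separation is therefore
  achieved by shrinking a neighbourhood of \<open>a\<close> in \<open>K\<close>, using compactness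
  of \<open>K\<close>.\<close>

lemma map_separated_off_A:
  assumes fc: "first_countable (subtopology Y (topspace Y - A))"
    and K: "compact_space K" "Hausdorff_space K" and f: "continuous_map K X f"
    and a: "a \<in> topspace K" "f a \<noteq> {y}" and y: "y \<in> topspace Y - A"
  obtains U W where "openin K U" "a \<in> U" "openin X W" "{y} \<in> W" "\<And>x. x \<in> U \<Longrightarrow> f x \<notin> W"
proof -
  obtain W where W: "\<And>n. openin (subtopology Y (topspace Y - A)) (W n)" "\<And>n. y \<in> W n" "decseq W"
    "\<And>U. openin (subtopology Y (topspace Y - A)) U \<Longrightarrow> y \<in> U \<Longrightarrow> \<exists>n. W n \<subseteq> U"
    by (rule first_countable_decseq_base[OF fc, of y]) (use y in auto)
  have WY: "openin Y (W n)" "W n \<subseteq> topspace Y - A" for n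
    using W(1)[of n] openin_off_A by (auto simp: openin_open_subtopology)
  let ?F = "{x \<in> topspace K. f x \<in> {{y}}}"
  have "closedin K ?F"
    by (rule closedin_continuous_map_preimage[OF f closedin_X_singleton[OF y]])
  moreover have "closedin K {a}" using K(2) a(1) by (rule closedin_Hausdorff_singleton)
  moreover have "disjnt {a} ?F" using a by simp
  ultimately obtain U V where UV: "openin K U" "openin K V" "{a} \<subseteq> U" "?F \<subseteq> V" "disjnt U V"
    using compact_Hausdorff_or_regular_imp_normal_space[OF K(1)] K(2)
    unfolding normal_space_def by meson
  \<comment> \<open>Otherwise points \<open>x n\<close> of \<open>U\<close> have values
    \<open>{\<tau> n}\<close> with \<open>\<tau>\<close> converging to \<open>y\<close>, and
    compactness produces a point of the fibre over \<open>{y}\<close> outside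
    \<open>V\<close>.\<close>
  have "\<exists>n. \<forall>x\<in>U. f x \<notin> (\<lambda>y. {y}) ` W n"
  proof (rule ccontr)
    assume "\<nexists>n. \<forall>x\<in>U. f x \<notin> (\<lambda>y. {y}) ` W n"
    then have "\<forall>n. \<exists>x z. x \<in> U \<and> z \<in> W n \<and> f x = {z}" by blast
    then obtain x \<tau> where x: "\<And>n. x n \<in> U" "\<And>n. \<tau> n \<in> W n" "\<And>n. f (x n) = {\<tau> n}"
      by metis
    have \<tau>: "range \<tau> \<subseteq> topspace Y - A" using x(2) WY(2) by blast
    have lim: "limitin Y \<tau> y sequentially"
      unfolding limitin_sequentially
    proof (intro conjI allI impI)
      show "y \<in> topspace Y" using y by simp
      fix G assume G: "openin Y G \<and> y \<in> G"
      then have "openin (subtopology Y (topspace Y - A)) ((topspace Y - A) \<inter> G)"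
        by (intro openin_subtopology_Int2) simp
      from W(4)[OF this] obtain N where "W N \<subseteq> G" using G y by auto
      moreover have "W n \<subseteq> W N" if "n \<ge> N" for n using W(3) that by (rule decseqD)
      ultimately show "\<exists>N. \<forall>n\<ge>N. \<tau> n \<in> G" using x(2) by (intro exI[of _ N]) auto
    qed
    \<comment> \<open>Removing \<open>V\<close> discards the whole fibre over \<open>{y}\<close> but
      keeps every \<open>x n\<close>, as \<open>U\<close> and \<open>V\<close> are disjoint. So
      \<open>C N\<close> is never empty, while a common point would map to
      \<open>{y}\<close>.\<close>
    define C where "C N = {p \<in> topspace K. f p \<in> (\<lambda>y. {y}) ` insert y (\<tau> ` {N..})} - V" for N
    have "(\<Inter>N. C N) \<noteq> {}"
    proof (rule compact_space_imp_nest[OF K(1)])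
      show "closedin K (C N)" for N
        unfolding C_def using y UV(2) \<tau>
        by (intro closedin_diff closedin_continuous_map_preimage[OF f] closedin_X_tail[OF lim]) auto
      show "C N \<noteq> {}" for N
      proof -
        have "x N \<in> topspace K" using x(1) UV(1) openin_subset by blast
        then have "x N \<in> C N" using x(1)[of N] x(3) UV(5) by (auto simp: C_def disjnt_def)
        then show ?thesis by blast
      qed
      show "decseq C" unfolding decseq_def C_def by fastforce
    qed
    then obtain p where p: "\<And>N. p \<in> C N" by blast
    then have "f p = {y}" by (intro mem_all_tails[OF lim \<tau>]) (simp add: C_def)
    then show False using p[of 0] UV(4) by (auto simp: C_def)
  qed
  then obtain n where "\<forall>x\<in>U. f x \<notin> (\<lambda>y. {y}) ` W n" by blast
  then show thesis
    using UV W(2) WY(1) WY(2)[of n]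
    by (intro that[of U "(\<lambda>y. {y}) ` W n"] openin_X_off_A) auto
qed

lemma k2_Hausdorff_space_X:
  assumes "first_countable (subtopology Y (topspace Y - A))"
  shows "k2_Hausdorff_space TYPE('k) X"
  unfolding k2_Hausdorff_space_def
proof (intro allI impI)
  fix K :: "'k topology" and f
  assume K: "compact_space K \<and> Hausdorff_space K \<and> continuous_map K X f"
  let ?E = "{(a, b) \<in> topspace K \<times> topspace K. f a = f b}"
  \<comment> \<open>\<open>V\<close> will be the preimage of a neighbourhood \<open>W\<close> of
    \<open>f b\<close> that \<open>f\<close> avoids on \<open>U\<close>.\<close>
  have sep: "\<exists>U V. openin K U \<and> openin K V \<and> a \<in> U \<and> b \<in> V \<and> (\<forall>x\<in>U. \<forall>x'\<in>V. f x \<noteq> f x')"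
    if ab: "a \<in> topspace K" "b \<in> topspace K" "f a \<noteq> f b" "f b \<noteq> A" for a b
  proof -
    have "f b \<in> topspace X" using K ab(2) continuous_map_image_subset_topspace by blast
    then obtain y where y: "y \<in> topspace Y - A" "f b = {y}" using ab(4) unfolding topspace_X by blast
    then obtain U W where "openin K U" "a \<in> U" "openin X W" "{y} \<in> W" "\<And>x. x \<in> U \<Longrightarrow> f x \<notin> W"
      using map_separated_off_A[OF assms, of K f a y] K ab by metis
    moreover define V where "V = {x \<in> topspace K. f x \<in> W}"
    moreover have "openin K V"
      unfolding V_def using K \<open>openin X W\<close> openin_continuous_map_preimage by blast
    moreover have "b \<in> V" using ab y \<open>{y} \<in> W\<close> by (simp add: V_def)
    moreover have "\<forall>x\<in>U. \<forall>x'\<in>V. f x \<noteq> f x'"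
      using \<open>\<And>x. x \<in> U \<Longrightarrow> f x \<notin> W\<close> unfolding V_def by force
    ultimately show ?thesis by blast
  qed
  have "openin (prod_topology K K) (topspace K \<times> topspace K - ?E)"
    unfolding openin_prod_topology_alt
  proof (intro allI impI)
    fix a b assume "(a, b) \<in> topspace K \<times> topspace K - ?E"
    then have ab: "a \<in> topspace K" "b \<in> topspace K" "f a \<noteq> f b" by auto
    have "\<exists>U V. openin K U \<and> openin K V \<and> a \<in> U \<and> b \<in> V \<and> (\<forall>x\<in>U. \<forall>x'\<in>V. f x \<noteq> f x')"
    \<comment> \<open>Distinct values cannot both be \<open>A\<close>, so exchanging
      \<open>a\<close> and \<open>b\<close> covers the remaining case.\<close>
    proof (cases "f b = A")
      case True
      then show ?thesis using sep[of b a] ab by metis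
    qed (use sep ab in blast)
    then obtain U V where UV: "openin K U" "openin K V" "a \<in> U" "b \<in> V"
      "\<forall>x\<in>U. \<forall>x'\<in>V. f x \<noteq> f x'" by blast
    moreover have "U \<times> V \<subseteq> topspace K \<times> topspace K - ?E"
      using UV(5) openin_subset[OF UV(1)] openin_subset[OF UV(2)] by auto
    ultimately show "\<exists>U V. openin K U \<and> openin K V \<and> a \<in> U \<and> b \<in> V \<and>
        U \<times> V \<subseteq> topspace K \<times> topspace K - ?E" by blast
  qed
  then show "closedin (prod_topology K K) ?E" by (auto simp: closedin_def)
qed

section \<open>Failure of weak Hausdorffness\<close>

lemma not_weakly_Hausdorff_space_X:
  assumes "compact_space Y"
  shows "\<not> weakly_Hausdorff_space X"
proof
  assume wH: "weakly_Hausdorff_space X"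
  obtain a where a: "a \<in> A" using A_nonempty by blast
  \<comment> \<open>If the finite set \<open>A\<close> were all of \<open>Y\<close>, its points
    would be isolated.\<close>
  have "topspace Y \<noteq> A"
  proof
    assume eq: "topspace Y = A"
    have "closedin Y (A - {a})"
      using Hausdorff_imp_t1_space[OF Hausdorff] A_subset finite_A
      unfolding t1_space_closedin_finite by blast
    then have "openin Y (topspace Y - (A - {a}))" by blast
    moreover have "topspace Y - (A - {a}) = {a}" using eq a by blast
    ultimately show False using no_isolated[of a] a A_subset by auto
  qed
  then obtain y where y: "y \<in> topspace Y - A" using A_subset by blast
  then obtain U where U: "openin Y U" "y \<in> U" "disjnt A (Y closure_of U)"
    using compact_Hausdorff_imp_regular_space[OF assms Hausdorff] closedin_A
    unfolding regular_space by meson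
  let ?C = "Y closure_of U"
  have C: "?C \<subseteq> topspace Y - A"
    using U(3) closure_of_subset_topspace[of Y U] by (auto simp: disjnt_def)
  have "compact_space (subtopology Y ?C)"
    using assms by (intro compact_space_subtopology closedin_compact_space) auto
  moreover have "continuous_map (subtopology Y ?C) X (collapse A)"
    using continuous_map_collapse by (rule continuous_map_from_subtopology)
  ultimately have "closedin X (collapse A ` topspace (subtopology Y ?C))"
    using weakly_Hausdorff_spaceD[OF wH] Hausdorff_space_subtopology[OF Hausdorff] by blast
  moreover have "collapse A ` topspace (subtopology Y ?C) = (\<lambda>y. {y}) ` ?C"
  proof -
    have "topspace (subtopology Y ?C) = ?C" using C by auto
    moreover have "collapse A z = {z}" if "z \<in> ?C" for z using that C by (auto simp: collapse_def)
    ultimately show ?thesis by simp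
  qed
  \<comment> \<open>A closed image would make \<open>?C\<close> nowhere dense, but \<open>?C\<close>
    contains the nonempty open set \<open>U\<close>.\<close>
  ultimately have "Y interior_of ?C = {}" using closedin_X_iff[OF C] by simp
  moreover have "U \<subseteq> Y interior_of ?C"
    using U(1) by (intro interior_of_maximal closure_of_subset openin_subset)
  ultimately show False using U(2) by blast
qed

end

section \<open>The product of the two quotients\<close>

theorem corollary7p13:
  fixes Y1 :: "'a topology" and Y2 :: "'b topology" and A1 :: "'a set" and A2 :: "'b set"
    and X1 :: "'a set topology" and X2 :: "'b set topology"
  assumes "compact_space Y1" and "Hausdorff_space Y1"
    and "\<forall>y \<in> topspace Y1. \<not> openin Y1 {y}"
    and "A1 \<subseteq> topspace Y1" and "finite A1" and "A1 \<noteq> {}"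
    and "first_countable (subtopology Y1 (topspace Y1 - A1))"
    and "X1 = FMQ Y1 A1 (dense_sets Y1)"
    and "compact_space Y2" and "Hausdorff_space Y2"
    and "\<forall>y \<in> topspace Y2. \<not> openin Y2 {y}"
    and "A2 \<subseteq> topspace Y2" and "finite A2" and "A2 \<noteq> {}"
    and "first_countable (subtopology Y2 (topspace Y2 - A2))"
    and "X2 = FMQ Y2 A2 (dense_sets Y2)"
  shows "US_space (prod_topology X1 X2) \<and>
         k2_Hausdorff_space TYPE('k) (prod_topology X1 X2) \<and>
         \<not> kc_space (prod_topology X1 X2) \<and>
         \<not> weakly_Hausdorff_space (prod_topology X1 X2)"
proof -
  interpret F1: finite_collapse Y1 A1
    by unfold_locales (use assms in auto)
  interpret F2: finite_collapse Y2 A2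
    by unfold_locales (use assms in auto)
  \<comment> \<open>The collapsed point of the second factor serves as the height of the
    slice.\<close>
  have "A2 \<in> topspace X2" using assms F2.topspace_X by simp
  then have "weakly_Hausdorff_space (prod_topology X1 X2) \<Longrightarrow> weakly_Hausdorff_space X1"
    by (rule weakly_Hausdorff_space_prod_topologyD[rotated])
  moreover have "\<not> weakly_Hausdorff_space X1"
    using F1.not_weakly_Hausdorff_space_X assms by simp
  ultimately have nw: "\<not> weakly_Hausdorff_space (prod_topology X1 X2)" by blast
  have nkc: "\<not> kc_space (prod_topology X1 X2)"
    using nw kc_space_imp_weakly_Hausdorff_space by blast
  have "US_space (prod_topology X1 X2)"
    using assms F1.US_space_X F2.US_space_X by (simp add: US_space_prod_topology)
  moreover have "k2_Hausdorff_space TYPE('k) (prod_topology X1 X2)"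
    unfolding \<open>X1 = _\<close> \<open>X2 = _\<close>
    by (intro k2_Hausdorff_space_prod_topology F1.k2_Hausdorff_space_X F2.k2_Hausdorff_space_X)
      fact+
  ultimately show ?thesis using nw nkc by blast
qed

end
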